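(* Let $G$ be a graph on which median dynamics is well defined, and let $(\eta_t)_{t\ge0}$ be median dynamics on $G$. For $p\in[0,1]$ let $(\xi^p_t)_{t\ge 0}$, $\xi^p_t(x)=\mathbf 1_{[0,p]}(\eta_t(x))$, be the corresponding majority dynamics with initial density $p$. Then $(\eta_t)_{t\ge0}$ converges almost surely if, and only if, the set of $p\in[0,1]$ such that majority dynamics $(\xi^p_t)_{t\ge0}$ fixates has full Lebesgue measure in $[0,1]$.
   Context: $G=(V(G),E(G))$ is a locally finite (possibly infinite) simple undirected graph with countable vertex set, and $x\sim y$ denotes adjacency. $N(x)=\{y: y\sim x\}$ and $\deg(x)$ is the number of neighbors of $x$. Convention: if $\deg(x)$ is even, $x$ itself is added to $N(x)$, so that $|N(x)|$ is always odd. Median dynamics $(\eta_t)_{t\ge0}$ has state space $[0,1]^{V(G)}$. The initial values $(\eta_0(x))_{x\in V(G)}$ are i.i.d. uniform on $[0,1]$. Independently, each vertex has an independent rate-one Poisson clock. At each ring $s$ of the clock of $x$, the value at $x$ is replaced by the median of $\{\eta_{s-}(z): z\in N(x)\}$ (counted with multiplicity), and no other value changes. Median dynamics is well defined on $G$ if, for every $x\in V(G)$ and $t\ge 0$, almost surely $\eta_t(x)$ can be determined from finitely many of the initial values (together with the clocks). More precisely, almost surely there are finitely many vertices $y$ for which there exist a path $x=x_1\sim x_2\sim\dots\sim x_n=y$ and times $t\ge s_1>s_2>\dots>s_{n-1}>0$ such that the clock of $x_i$ rings at time $s_i$ for each $i\le n-1$. This holds in particular for finite graphs and bounded-degree graphs.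 The process $(\xi^p_t)_{t\ge0}$ is majority dynamics started from i.i.d. $\mathrm{Bernoulli}(p)$ values: when the clock of $x$ rings, the $\{0,1\}$-value at $x$ is replaced by the most common value in $N(x)$. Median dynamics converges almost surely if for every $x\in V(G)$ the limit $\lim_{t\to\infty}\eta_t(x)$ exists almost surely. Majority dynamics $(\xi^p_t)_{t\ge0}$ fixates if for every $x\in V(G)$, almost surely, $\xi^p_t(x)$ is constant for all $t$ large enough (beyond some random time). *)

theory Defs
  imports "HOL-Probability.Probability" "HOL-Library.Multiset"
begin

locale locally_finite_graph =
  fixes V :: "'v set" and E :: "'v rel"
  assumes countable_vertices: "countable V"
    and edges_in_vertices: "E \<subseteq> V \<times> V"
    and sym_edges: "sym E"
    and irrefl_edges: "irrefl E"
    and finite_degree: "x \<in> V \<Longrightarrow> finite (E `` {x})"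

text \<open>The vertex itself is included exactly when its degree is even, so that the neighborhood
  always has odd cardinality.\<close>

definition nbhd :: "'v rel \<Rightarrow> 'v \<Rightarrow> 'v set" where
  "nbhd E x = (if even (card (E `` {x})) then insert x (E `` {x}) else E `` {x})"

definition median_on :: "'v set \<Rightarrow> ('v \<Rightarrow> real) \<Rightarrow> real" where
  "median_on N f = sorted_list_of_multiset (image_mset f (mset_set N)) ! (card N div 2)"

definition majority_on :: "'v set \<Rightarrow> ('v \<Rightarrow> real) \<Rightarrow> real" where
  "majority_on N f = (if card {z \<in> N. f z = 0} < card {z \<in> N. f z = 1} then 1 else 0)"

text \<open>A rate-one Poisson clock is given by its independent exponential waiting times;
  \<open>ring_times w\<close> is the set of rings of the clock with waiting times \<open>w 0, w 1, \<dots>\<close>.\<close>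

definition ring_times :: "(nat \<Rightarrow> real) \<Rightarrow> real set" where
  "ring_times w = range (\<lambda>n. \<Sum>i\<le>n. w i)"

definition left_limit :: "(real \<Rightarrow> 'v \<Rightarrow> real) \<Rightarrow> real \<Rightarrow> 'v \<Rightarrow> real" where
  "left_limit h t z = Lim (at_left t) (\<lambda>s. h s z)"

text \<open>\<open>h\<close> is a trajectory in \<open>S\<^sup>V\<close> driven by clocks with ring sets \<open>R x\<close>: at a ring of the clock of \<open>x\<close> the
  value at \<open>x\<close> is recomputed by \<open>upd\<close> from the values on the neighborhood of \<open>x\<close> just before the
  ring, and the value at \<open>x\<close> does not change otherwise. Only times \<open>t \<ge> 0\<close> and vertices in \<open>V\<close> matter.\<close>

definition trajectory ::
    "'v set \<Rightarrow> 'v rel \<Rightarrow> real set \<Rightarrow> ('v set \<Rightarrow> ('v \<Rightarrow> real) \<Rightarrow> real) \<Rightarrow> ('v \<Rightarrow> real set) \<Rightarrow>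
      (real \<Rightarrow> 'v \<Rightarrow> real) \<Rightarrow> bool" where
  "trajectory V E S upd R h \<longleftrightarrow>
     (\<forall>x\<in>V. \<forall>t\<ge>0. h t x \<in> S) \<and>
     (\<forall>x\<in>V. \<forall>t>0. t \<in> R x \<longrightarrow> h t x = upd (nbhd E x) (left_limit h t)) \<and>
     (\<forall>x\<in>V. \<forall>s\<ge>0. \<forall>t\<ge>s. R x \<inter> {s<..t} = {} \<longrightarrow> h t x = h s x)"

text \<open>The stochastic process \<open>X\<close> with state space \<open>S\<^sup>V\<close>, i.i.d. initial values of law \<open>\<mu>\<close>, and independent
  rate-one Poisson clocks with waiting times \<open>W x n\<close>; the clocks are also independent of the
  initial values.\<close>

locale clock_dynamics = prob_space M + locally_finite_graph V E
  for M :: "'w measure" and V :: "'v set" and E :: "'v rel" +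
  fixes S :: "real set" and upd :: "'v set \<Rightarrow> ('v \<Rightarrow> real) \<Rightarrow> real" and \<mu> :: "real measure"
    and W :: "'v \<Rightarrow> nat \<Rightarrow> 'w \<Rightarrow> real" and X :: "real \<Rightarrow> 'v \<Rightarrow> 'w \<Rightarrow> real"
  assumes random_variable: "x \<in> V \<Longrightarrow> 0 \<le> t \<Longrightarrow> random_variable borel (X t x)"
    and initial_law: "x \<in> V \<Longrightarrow> distr M borel (X 0 x) = \<mu>"
    and waiting_time_law: "x \<in> V \<Longrightarrow> distributed M lborel (W x n) (exponential_density 1)"
    and independent:
      "indep_vars (\<lambda>_. borel) (case_sum (X 0) (\<lambda>(x, n). W x n)) (V <+> V \<times> UNIV)"
    and evolution:
      "AE \<omega> in M. trajectory V E S upd (\<lambda>x. ring_times (\<lambda>n. W x n \<omega>)) (\<lambda>t x. X t x \<omega>)"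

definition median_dynamics ::
    "'w measure \<Rightarrow> 'v set \<Rightarrow> 'v rel \<Rightarrow> ('v \<Rightarrow> nat \<Rightarrow> 'w \<Rightarrow> real) \<Rightarrow> (real \<Rightarrow> 'v \<Rightarrow> 'w \<Rightarrow> real) \<Rightarrow> bool" where
  "median_dynamics M V E W \<eta> \<longleftrightarrow>
     clock_dynamics M V E {0..1} median_on (uniform_measure lborel {0..1}) W \<eta>"

definition majority_dynamics ::
    "'w measure \<Rightarrow> 'v set \<Rightarrow> 'v rel \<Rightarrow> real \<Rightarrow> ('v \<Rightarrow> nat \<Rightarrow> 'w \<Rightarrow> real) \<Rightarrow>
      (real \<Rightarrow> 'v \<Rightarrow> 'w \<Rightarrow> real) \<Rightarrow> bool" where
  "majority_dynamics M V E p W \<xi> \<longleftrightarrow>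
     clock_dynamics M V E {0, 1} majority_on (distr (measure_pmf (bernoulli_pmf p)) borel of_bool) W \<xi>"

text \<open>The vertices whose initial value may influence the value at \<open>x\<close> at time \<open>t\<close>: endpoints of paths
  \<open>xs\<close> from \<open>x\<close> along which, going backwards in time from \<open>t\<close>, all vertices but the last ring
  at the successive times \<open>ss\<close>.\<close>

definition backward_cluster ::
    "'v rel \<Rightarrow> ('v \<Rightarrow> real set) \<Rightarrow> 'v \<Rightarrow> real \<Rightarrow> 'v set" where
  "backward_cluster E R x t =
     {y. \<exists>xs ss. length xs = Suc (length ss) \<and> hd xs = x \<and> last xs = y \<and>
           (\<forall>i<length ss. (xs ! i, xs ! Suc i) \<in> E \<and> ss ! i \<in> R (xs ! i)) \<and>
           sorted_wrt (>) ss \<and> (\<forall>s\<in>set ss. 0 < s \<and> s \<le> t)}"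

text \<open>A property of the graph only: the clocks are realized on the canonical product space of
  i.i.d. exponential waiting times.\<close>

definition median_well_defined :: "'v set \<Rightarrow> 'v rel \<Rightarrow> bool" where
  "median_well_defined V E \<longleftrightarrow>
     (\<forall>x\<in>V. \<forall>t\<ge>0. AE w in (\<Pi>\<^sub>M i\<in>V \<times> (UNIV :: nat set). density lborel (exponential_density 1)).
        finite (backward_cluster E (\<lambda>y. ring_times (\<lambda>n. w (y, n))) x t))"

definition converges_almost_surely ::
    "'w measure \<Rightarrow> 'v set \<Rightarrow> (real \<Rightarrow> 'v \<Rightarrow> 'w \<Rightarrow> real) \<Rightarrow> bool" where
  "converges_almost_surely M V \<eta> \<longleftrightarrow>
     (\<forall>x\<in>V. AE \<omega> in M. \<exists>L. ((\<lambda>t. \<eta> t x \<omega>) \<longlongrightarrow> L) at_top)"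

definition fixates :: "'w measure \<Rightarrow> 'v set \<Rightarrow> (real \<Rightarrow> 'v \<Rightarrow> 'w \<Rightarrow> real) \<Rightarrow> bool" where
  "fixates M V \<xi> \<longleftrightarrow> (\<forall>x\<in>V. AE \<omega> in M. \<exists>T\<ge>0. \<forall>t\<ge>T. \<xi> t x \<omega> = \<xi> T x \<omega>)"

definition threshold :: "(real \<Rightarrow> 'v \<Rightarrow> 'w \<Rightarrow> real) \<Rightarrow> real \<Rightarrow> real \<Rightarrow> 'v \<Rightarrow> 'w \<Rightarrow> real" where
  "threshold \<eta> p t x \<omega> = indicator {0..p} (\<eta> t x \<omega>)"

lemma card_nbhd_odd:
  assumes "locally_finite_graph V E" "x \<in> V"
  shows "finite (nbhd E x)" "odd (card (nbhd E x))" "nbhd E x \<subseteq> V"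
proof -
  interpret locally_finite_graph V E by fact
  have "finite (E `` {x})" using finite_degree assms(2) by blast
  moreover have "x \<notin> E `` {x}" using irrefl_edges by (auto simp: irrefl_def)
  ultimately show "finite (nbhd E x)" "odd (card (nbhd E x))" by (auto simp: nbhd_def)
  show "nbhd E x \<subseteq> V" using edges_in_vertices assms(2) by (auto simp: nbhd_def)
qed

lemma sorted_nth_le_iff:
  fixes xs :: "real list"
  assumes "sorted xs" "k < length xs"
  shows "xs ! k \<le> p \<longleftrightarrow> k < length (filter (\<lambda>a. a \<le> p) xs)"
proof -
  have *: "filter (\<lambda>a. a \<le> p) xs = takeWhile (\<lambda>a. a \<le> p) xs"
    using assms(1)
  proof (induction xs)
    case (Cons a xs)
    show ?case
    proof (cases "a \<le> p")
      case False
      then have "\<forall>b\<in>set xs. \<not> b \<le> p" using Cons.prems by auto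
      then show ?thesis using False by (simp add: filter_empty_conv)
    qed (use Cons in simp)
  qed simp
  show ?thesis
  proof
    assume le: "xs ! k \<le> p"
    show "k < length (filter (\<lambda>a. a \<le> p) xs)"
    proof (rule ccontr)
      assume "\<not> ?thesis"
      then have l: "length (takeWhile (\<lambda>a. a \<le> p) xs) \<le> k" by (simp add: *)
      then have "length (takeWhile (\<lambda>a. a \<le> p) xs) < length xs" using assms(2) by simp
      then have "\<not> xs ! length (takeWhile (\<lambda>a. a \<le> p) xs) \<le> p" using nth_length_takeWhile by blast
      moreover have "xs ! length (takeWhile (\<lambda>a. a \<le> p) xs) \<le> xs ! k"
        using assms l by (simp add: sorted_nth_mono)
      ultimately show False using le by simp
    qed
  next
    assume "k < length (filter (\<lambda>a. a \<le> p) xs)"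
    then have k: "k < length (takeWhile (\<lambda>a. a \<le> p) xs)" by (simp add: *)
    then have "takeWhile (\<lambda>a. a \<le> p) xs ! k = xs ! k" by (rule takeWhile_nth)
    moreover have "takeWhile (\<lambda>a. a \<le> p) xs ! k \<in> set (takeWhile (\<lambda>a. a \<le> p) xs)" using k by simp
    ultimately show "xs ! k \<le> p" by (metis set_takeWhileD)
  qed
qed

lemma median_on_le_iff:
  assumes "finite N" "odd (card N)"
  shows "median_on N f \<le> p \<longleftrightarrow> card N div 2 < card {z \<in> N. f z \<le> p}"
proof -
  let ?M = "image_mset f (mset_set N)"
  let ?xs = "sorted_list_of_multiset ?M"
  have len: "length ?xs = card N"
    by (metis size_image_mset size_mset size_mset_set mset_sorted_list_of_multiset)
  have "length (filter (\<lambda>a. a \<le> p) ?xs) = size (filter_mset (\<lambda>a. a \<le> p) ?M)"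
    by (metis mset_filter mset_sorted_list_of_multiset size_mset)
  also have "\<dots> = card {z \<in> N. f z \<le> p}"
    using assms(1) by (simp add: filter_mset_image_mset)
  finally show ?thesis
    unfolding median_on_def using assms
    by (subst sorted_nth_le_iff) (auto simp: len sorted_sorted_list_of_multiset odd_pos)
qed

lemma median_on_in:
  assumes "finite N" "odd (card N)"
  shows "median_on N f \<in> f ` N"
proof -
  let ?M = "image_mset f (mset_set N)"
  let ?xs = "sorted_list_of_multiset ?M"
  have len: "length ?xs = card N"
    by (metis size_image_mset size_mset size_mset_set mset_sorted_list_of_multiset)
  have "median_on N f \<in> set ?xs"
    unfolding median_on_def using assms by (intro nth_mem) (auto simp: len odd_pos)
  then show ?thesis using assms(1) by simp
qed

lemma threshold_median_on:
  assumes "finite N" "odd (card N)" "\<And>z. z \<in> N \<Longrightarrow> 0 \<le> f z"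
  shows "indicator {0..p} (median_on N f) = majority_on N (\<lambda>z. indicator {0..p} (f z))"
proof -
  have "0 \<le> median_on N f" using median_on_in[OF assms(1,2), of f] assms(3) by auto
  moreover have 1: "{z \<in> N. (indicator {0..p} (f z) :: real) = 1} = {z \<in> N. f z \<le> p}"
    and 0: "{z \<in> N. (indicator {0..p} (f z) :: real) = 0} = N - {z \<in> N. f z \<le> p}"
    using assms(3) by (auto simp: indicator_def)
  have "card (N - {z \<in> N. f z \<le> p}) = card N - card {z \<in> N. f z \<le> p}"
    using assms(1) by (simp add: card_Diff_subset)
  moreover have "card {z \<in> N. f z \<le> p} \<le> card N" using assms(1) by (simp add: card_mono)
  ultimately show ?thesis
    unfolding majority_on_def 0 1 using median_on_le_iff[OF assms(1,2), of f p] assms(2)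
    by (auto simp: indicator_def elim!: oddE)
qed

context clock_dynamics
begin

lemma AE_rings_unbounded:
  assumes x: "x \<in> V"
  shows "AE \<omega> in M. \<forall>B. \<exists>n. B < (\<Sum>i\<le>n. W x i \<omega>)"
proof -
  have rv[measurable]: "random_variable borel (W x n)" for n
    using waiting_time_law[OF x, of n] by (auto simp: distributed_def)
  have "AE \<omega> in M. \<exists>n. real k < (\<Sum>i\<le>n. W x i \<omega>)" for k :: nat
  proof -
    define A where "A = {\<omega> \<in> space M. \<forall>n. (\<Sum>i\<le>n. W x i \<omega>) \<le> real k}"
    have [measurable]: "A \<in> events" unfolding A_def by measurable
    have "prob A \<le> erlang_CDF n 1 (real k)" for n
    proof -
      define J :: "('v + 'v \<times> nat) set" where "J = (\<lambda>n. Inr (x, n)) ` {..n}"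
      have inj: "inj_on (\<lambda>n. Inr (x, n) :: 'v + 'v \<times> nat) {..n}" by (auto intro: inj_onI)
      have "distributed M lborel (\<lambda>\<omega>. \<Sum>i\<in>J. case_sum (X 0) (\<lambda>(x, n). W x n) i \<omega>)
          (erlang_density (card J - 1) 1)"
      proof (rule exponential_distributed_sum)
        show "indep_vars (\<lambda>_. borel) (case_sum (X 0) (\<lambda>(x, n). W x n)) J"
          by (rule indep_vars_subset[OF independent]) (use x in \<open>auto simp: J_def\<close>)
        show "distributed M lborel (case_sum (X 0) (\<lambda>(x, n). W x n) i) (exponential_density 1)"
          if "i \<in> J" for i
          using that waiting_time_law[OF x] by (auto simp: J_def)
      qed (auto simp: J_def)
      moreover have "card J - 1 = n" using inj by (simp add: J_def card_image)
      moreover have "(\<Sum>i\<in>J. case_sum (X 0) (\<lambda>(x, n). W x n) i \<omega>) = (\<Sum>i\<le>n. W x i \<omega>)" for \<omega>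
        unfolding J_def by (subst sum.reindex[OF inj]) simp
      ultimately have "distributed M lborel (\<lambda>\<omega>. \<Sum>i\<le>n. W x i \<omega>) (erlang_density n 1)"
        by simp
      then have "\<P>(\<omega> in M. (\<Sum>i\<le>n. W x i \<omega>) \<le> real k) = erlang_CDF n 1 (real k)"
        by (intro erlang_distributed_le) auto
      moreover have "prob A \<le> \<P>(\<omega> in M. (\<Sum>i\<le>n. W x i \<omega>) \<le> real k)"
        by (rule finite_measure_mono) (auto simp: A_def)
      ultimately show ?thesis by simp
    qed
    moreover have "(\<lambda>n. erlang_CDF n 1 (real k)) \<longlonglongrightarrow> 0"
    proof -
      have "(\<lambda>n. \<Sum>i<n. real k ^ i / fact i) \<longlonglongrightarrow> exp (real k)"
        using exp_converges[of "real k"] by (simp add: sums_def divide_inverse mult.commute)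
      then have "(\<lambda>n. \<Sum>i\<le>n. real k ^ i / fact i) \<longlonglongrightarrow> exp (real k)"
        by (simp add: LIMSEQ_lessThan_iff_atMost)
      then have "(\<lambda>n. 1 - (\<Sum>i\<le>n. real k ^ i / fact i) * exp (- real k)) \<longlonglongrightarrow> 1 - exp (real k) * exp (- real k)"
        by (intro tendsto_intros)
      then show ?thesis
        unfolding sum_distrib_right exp_add[symmetric] by (simp add: erlang_CDF_def)
    qed
    ultimately have "prob A \<le> 0" by (intro LIMSEQ_le_const) auto
    then have "A \<in> null_sets M"
      using measure_nonneg[of M A] by (intro null_setsI) (auto simp: emeasure_eq_measure)
    then show ?thesis
      by (rule AE_I') (auto simp: A_def not_less)
  qed
  then have "AE \<omega> in M. \<forall>k::nat. \<exists>n. real k < (\<Sum>i\<le>n. W x i \<omega>)"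
    by (simp add: AE_all_countable)
  then show ?thesis
  proof (rule AE_mp, intro AE_I2 impI allI)
    fix \<omega> B assume "\<forall>k::nat. \<exists>n. real k < (\<Sum>i\<le>n. W x i \<omega>)"
    then show "\<exists>n. B < (\<Sum>i\<le>n. W x i \<omega>)"
      by (metis less_trans reals_Archimedean2)
  qed
qed

lemma AE_waiting_time_nonneg:
  assumes x: "x \<in> V"
  shows "AE \<omega> in M. 0 \<le> W x n \<omega>"
proof -
  have rv[measurable]: "random_variable borel (W x n)"
    using waiting_time_law[OF x, of n] by (auto simp: distributed_def)
  have "\<P>(\<omega> in M. 0 < W x n \<omega>) = 1"
    using exponential_distributedD_gt[OF waiting_time_law[OF x, of n], of 0] by simp
  then have "AE \<omega> in M. 0 < W x n \<omega>"
    by (subst (asm) prob_Collect_eq_1) auto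
  then show ?thesis by eventually_elim simp
qed

lemma AE_rings_locally_finite:
  "AE \<omega> in M. \<forall>x\<in>V. \<forall>t. finite (ring_times (\<lambda>n. W x n \<omega>) \<inter> {..t})"
proof -
  have "AE \<omega> in M. \<forall>t. finite (ring_times (\<lambda>n. W x n \<omega>) \<inter> {..t})" if x: "x \<in> V" for x
  proof -
    have "AE \<omega> in M. \<forall>n. 0 \<le> W x n \<omega>"
      using AE_waiting_time_nonneg[OF x] by (simp add: AE_all_countable)
    then show ?thesis using AE_rings_unbounded[OF x]
    proof eventually_elim
      case (elim \<omega>)
      show ?case
      proof
        fix t
        obtain n where n: "t < (\<Sum>i\<le>n. W x i \<omega>)" using elim(2) by blast
        have "ring_times (\<lambda>n. W x n \<omega>) \<inter> {..t} \<subseteq> (\<lambda>n. \<Sum>i\<le>n. W x i \<omega>) ` {..n}"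
        proof
          fix s assume "s \<in> ring_times (\<lambda>n. W x n \<omega>) \<inter> {..t}"
          then obtain m where m: "s = (\<Sum>i\<le>m. W x i \<omega>)" "s \<le> t" by (auto simp: ring_times_def)
          have "m \<le> n"
          proof (rule ccontr)
            assume "\<not> m \<le> n"
            then have "(\<Sum>i\<le>n. W x i \<omega>) \<le> (\<Sum>i\<le>m. W x i \<omega>)"
              using elim(1) by (intro sum_mono2) auto
            then show False using m n by simp
          qed
          then show "s \<in> (\<lambda>n. \<Sum>i\<le>n. W x i \<omega>) ` {..n}" using m by auto
        qed
        then show "finite (ring_times (\<lambda>n. W x n \<omega>) \<inter> {..t})" by (rule finite_subset) simp
      qed
    qed
  qed
  then show ?thesis by (subst AE_ball_countable[OF countable_vertices]) auto
qed

end

lemma trajectory_left_constant: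
  assumes "trajectory V E S upd R h" "z \<in> V" "0 < t" "finite (R z \<inter> {..t})"
  obtains s where "0 \<le> s" "s < t" "\<And>u. s \<le> u \<Longrightarrow> u < t \<Longrightarrow> h u z = h s z"
proof -
  define s where "s = Max (insert 0 (R z \<inter> {0..<t}))"
  have fin: "finite (R z \<inter> {0..<t})" by (rule finite_subset[OF _ assms(4)]) auto
  have s: "0 \<le> s" "s < t" unfolding s_def using fin assms(3) by (auto simp: Max_less_iff)
  have "h u z = h s z" if u: "s \<le> u" "u < t" for u
  proof -
    have "R z \<inter> {s<..u} = {}"
    proof (rule ccontr)
      assume "R z \<inter> {s<..u} \<noteq> {}"
      then obtain v where v: "v \<in> R z" "s < v" "v \<le> u" by auto
      then have "v \<le> s" unfolding s_def using fin u s by (intro Max_ge) auto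
      then show False using v by simp
    qed
    then show ?thesis using assms(1,2) s u unfolding trajectory_def by blast
  qed
  then show thesis using that s by blast
qed

lemma left_limit_trajectory:
  assumes "trajectory V E S upd R h" "z \<in> V" "0 < t" "finite (R z \<inter> {..t})"
  shows "left_limit h t z \<in> S"
    and "left_limit (\<lambda>t z. g (h t z)) t z = g (left_limit h t z)"
proof -
  obtain s where s: "0 \<le> s" "s < t" "\<And>u. s \<le> u \<Longrightarrow> u < t \<Longrightarrow> h u z = h s z"
    using trajectory_left_constant[OF assms] by blast
  have ev: "eventually (\<lambda>u. h u z = h s z) (at_left t)"
    using eventually_at_left_real[OF s(2)] by eventually_elim (auto intro: s(3))
  have lim: "left_limit (\<lambda>t z. f (h t z)) t z = f (h s z)" for f
    unfolding left_limit_def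
  proof (rule tendsto_Lim)
    show "((\<lambda>u. f (h u z)) \<longlongrightarrow> f (h s z)) (at_left t)"
      by (rule tendsto_eventually) (use ev in eventually_elim, simp)
  qed (simp add: trivial_limit_at_left_real)
  from lim[of "\<lambda>a. a"] have 1: "left_limit h t z = h s z" by simp
  have "h s z \<in> S" using assms(1,2) s(1) unfolding trajectory_def by blast
  with 1 show "left_limit h t z \<in> S" by simp
  show "left_limit (\<lambda>t z. g (h t z)) t z = g (left_limit h t z)" using lim[of g] 1 by simp
qed

lemma trajectory_threshold:
  assumes G: "locally_finite_graph V E"
    and h: "trajectory V E {0..1} median_on R h"
    and fin: "\<forall>x\<in>V. \<forall>t. finite (R x \<inter> {..t})"
  shows "trajectory V E {0, 1} majority_on R (\<lambda>t x. indicator {0..p} (h t x))"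
  unfolding trajectory_def
proof (intro conjI ballI allI impI)
  fix x t assume x: "x \<in> V" and t: "(0::real) < t" "t \<in> R x"
  let ?N = "nbhd E x"
  note N = card_nbhd_odd[OF G x]
  have L: "left_limit h t z \<in> {0..1}"
    "left_limit (\<lambda>t z. indicator {0..p} (h t z)) t z = indicator {0..p} (left_limit h t z)"
    if "z \<in> ?N" for z
    using left_limit_trajectory[OF h, of z t] that N(3) t fin by auto
  have "indicator {0..p} (h t x) = indicator {0..p} (median_on ?N (left_limit h t))"
    using h x t unfolding trajectory_def by simp
  also have "\<dots> = majority_on ?N (\<lambda>z. indicator {0..p} (left_limit h t z))"
    by (rule threshold_median_on) (use N L in auto)
  also have "\<dots> = majority_on ?N (left_limit (\<lambda>t z. indicator {0..p} (h t z)) t)"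
  proof -
    have "{z \<in> ?N. indicator {0..p} (left_limit h t z) = c} =
        {z \<in> ?N. left_limit (\<lambda>t z. indicator {0..p} (h t z)) t z = c}" for c :: real
      using L(2) by auto
    then show ?thesis unfolding majority_on_def by simp
  qed
  finally show "indicator {0..p} (h t x) = majority_on ?N (left_limit (\<lambda>t z. indicator {0..p} (h t z)) t)" .
next
  fix x s t assume "x \<in> V" "(0::real) \<le> s" "s \<le> t" "R x \<inter> {s<..t} = {}"
  then have "h t x = h s x" using h unfolding trajectory_def by blast
  then show "(indicator {0..p} (h t x) :: real) = indicator {0..p} (h s x)" by simp
qed (auto simp: indicator_def)

lemma distr_indicator_uniform:
  fixes p :: real
  assumes "0 \<le> p" "p \<le> 1"
  shows "distr (uniform_measure lborel {0..1::real}) borel (indicator {0..p}) =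
    (distr (measure_pmf (bernoulli_pmf p)) borel of_bool :: real measure)"
proof (rule measure_eqI)
  let ?U = "uniform_measure lborel {0..1::real}"
  fix A :: "real set" assume "A \<in> sets (distr ?U borel (indicator {0..p}))"
  then have A[measurable]: "A \<in> sets borel" by simp
  have "emeasure (distr ?U borel (indicator {0..p})) A = emeasure ?U (indicator {0..p} -` A)"
    by (subst emeasure_distr) (auto simp: uniform_measure_def space_density)
  also have "\<dots> = emeasure lborel ({0..1} \<inter> (indicator {0..p} -` A))"
  proof -
    have "(indicator {0..p} :: real \<Rightarrow> real) -` A \<in> sets lborel"
      using measurable_sets[of "indicator {0..p} :: real \<Rightarrow> real" borel borel A] by simp
    then show ?thesis by (simp add: divide_ennreal_def)
  qed
  also have "{0..1} \<inter> ((indicator {0..p} :: real \<Rightarrow> real) -` A) =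
      (if 1 \<in> A then {0..p} else {}) \<union> (if 0 \<in> A then {p<..1} else {})"
    (is "?L = ?R")
  proof (rule set_eqI)
    fix x :: real
    show "x \<in> ?L \<longleftrightarrow> x \<in> ?R" using assms by (cases "x \<le> p") (auto simp: indicator_def)
  qed
  also have "emeasure lborel \<dots> = (if 1 \<in> A then ennreal p else 0) + (if 0 \<in> A then ennreal (1 - p) else 0)"
    using assms by (subst plus_emeasure[symmetric]) auto
  also have "\<dots> = emeasure (measure_pmf (bernoulli_pmf p)) (of_bool -` A)"
  proof -
    have "finite (of_bool -` A :: bool set)" by simp
    then have "emeasure (measure_pmf (bernoulli_pmf p)) (of_bool -` A) =
        (\<Sum>b\<in>of_bool -` A. ennreal (pmf (bernoulli_pmf p) b))"
      by (simp add: emeasure_measure_pmf_finite sum_ennreal)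
    also have eq: "(of_bool -` A :: bool set) = (if 1 \<in> A then {True} else {}) \<union> (if 0 \<in> A then {False} else {})"
      by (auto simp: of_bool_def split: if_splits)
    also have "(\<Sum>b\<in>\<dots>. ennreal (pmf (bernoulli_pmf p) b)) =
        (if 1 \<in> A then ennreal p else 0) + (if 0 \<in> A then ennreal (1 - p) else 0)"
      using assms by auto
    finally show ?thesis unfolding eq by simp
  qed
  also have "\<dots> = emeasure (distr (measure_pmf (bernoulli_pmf p)) borel of_bool) A"
    by (subst emeasure_distr) auto
  finally show "emeasure (distr ?U borel (indicator {0..p})) A =
    emeasure (distr (measure_pmf (bernoulli_pmf p)) borel of_bool) A" .
qed simp

text \<open>Thresholding median dynamics at level \<open>p\<close> gives majority dynamics, driven by the same clocks,
  with initial density \<open>p\<close>.\<close>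

lemma majority_dynamics_threshold:
  fixes M :: "'w measure" and V :: "'v set"
  assumes "median_dynamics M V E W \<eta>" "0 \<le> p" "p \<le> 1"
  shows "majority_dynamics M V E p W (threshold \<eta> p)"
proof -
  interpret clock_dynamics M V E "{0..1}" median_on "uniform_measure lborel {0..1}" W \<eta>
    using assms(1) unfolding median_dynamics_def .
  have thr: "threshold \<eta> p t x = (\<lambda>\<omega>. indicator {0..p} (\<eta> t x \<omega>))" for t x
    by (simp add: threshold_def fun_eq_iff)
  show ?thesis
    unfolding majority_dynamics_def
  proof unfold_locales
    fix x and t :: real assume "x \<in> V" "0 \<le> t"
    note [measurable] = random_variable[OF this]
    show "random_variable borel (threshold \<eta> p t x)" unfolding thr by measurable
  next
    fix x assume x: "x \<in> V"
    note [measurable] = random_variable[OF x, of 0, simplified]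
    have "distr M borel (threshold \<eta> p 0 x) = distr (distr M borel (\<eta> 0 x)) borel (indicator {0..p})"
      unfolding thr by (subst distr_distr) (auto simp: comp_def)
    also have "\<dots> = distr (measure_pmf (bernoulli_pmf p)) borel of_bool"
      unfolding initial_law[OF x] using distr_indicator_uniform assms(2,3) by simp
    finally show "distr M borel (threshold \<eta> p 0 x) = distr (measure_pmf (bernoulli_pmf p)) borel of_bool" .
  next
    show "distributed M lborel (W x n) (exponential_density 1)" if "x \<in> V" for x n
      using waiting_time_law that .
  next
    define Y where "Y i = (case_sum (\<lambda>_. indicator {0..p}) (\<lambda>_ a. a) i :: real \<Rightarrow> real)"
      for i :: "'v + 'v \<times> nat"
    have "indep_vars (\<lambda>_. borel) (\<lambda>i \<omega>. Y i (case_sum (\<eta> 0) (\<lambda>(x, n). W x n) i \<omega>)) (V <+> V \<times> UNIV)"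
      by (rule indep_vars_compose2[OF independent]) (auto simp: Y_def split: sum.split)
    moreover have "(\<lambda>i \<omega>. Y i (case_sum (\<eta> 0) (\<lambda>(x, n). W x n) i \<omega>)) =
        case_sum (threshold \<eta> p 0) (\<lambda>(x, n). W x n)"
      by (auto simp: fun_eq_iff Y_def thr split: sum.split)
    ultimately show "indep_vars (\<lambda>_. borel) (case_sum (threshold \<eta> p 0) (\<lambda>(x, n). W x n)) (V <+> V \<times> UNIV)"
      by simp
  next
    show "AE \<omega> in M. trajectory V E {0, 1} majority_on (\<lambda>x. ring_times (\<lambda>n. W x n \<omega>))
        (\<lambda>t x. threshold \<eta> p t x \<omega>)"
      using evolution AE_rings_locally_finite
      by eventually_elim (simp add: thr trajectory_threshold[OF locally_finite_graph_axioms])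
  qed
qed

end

theory Submission
  imports Defs
begin

text \<open>Convergence of a bounded trajectory and eventual constancy of its thresholds are equivalent up
  to exceptional levels, and the exceptional levels are few. Both directions look at one vertex \<open>x\<close>
  at a time.

  If \<open>\<eta>\<^sub>t(x)\<close> converges to \<open>L\<^sub>x\<close>, then its threshold at level \<open>p\<close> is eventually constant as soon as
  \<open>L\<^sub>x \<noteq> p\<close>, because the trajectory ends up strictly on one side of \<open>p\<close>. Hence fixation at level \<open>p\<close>
  can fail only if \<open>p\<close> is an atom of the law of some \<open>L\<^sub>x\<close>. Each law has countably many atoms and
  there are countably many vertices, so the exceptional levels form a countable, hence Lebesgue
  null, set (lemma \<open>countable_nonfixating_levels\<close>).

  Conversely, a set of levels of full measure is dense. A bounded trajectory that fails to converge
  oscillates across every level strictly between its lower and upper limit, so it cannot have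
  eventually constant thresholds on a dense set of levels
  (lemma \<open>converges_if_threshold_constant_on_dense\<close>).\<close>

section \<open>Thresholds of a single trajectory\<close>

text \<open>Only \<open>p = L\<close> is excluded: there the trajectory may approach its limit from both sides and
  cross the level forever.\<close>

lemma threshold_eventually_constant:
  fixes h :: "real \<Rightarrow> real"
  assumes nonneg: "\<And>t. 0 \<le> t \<Longrightarrow> 0 \<le> h t"
    and lim: "(h \<longlongrightarrow> L) at_top" and neq: "L \<noteq> p"
  shows "\<exists>T\<ge>0. \<forall>t\<ge>T. (indicator {0..p} (h t) :: real) = indicator {0..p} (h T)"
proof -
  have "\<exists>c::real. eventually (\<lambda>t. indicator {0..p} (h t) = c) at_top"
  proof (cases "L < p")
    case True
    have "eventually (\<lambda>t. indicator {0..p} (h t) = (1::real)) at_top"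
      using order_tendstoD(2)[OF lim True] eventually_ge_at_top[of 0]
      by eventually_elim (use nonneg in auto)
    then show ?thesis ..
  next
    case False
    with neq have "p < L" by simp
    then have "eventually (\<lambda>t. indicator {0..p} (h t) = (0::real)) at_top"
      by (rule eventually_mono[OF order_tendstoD(1)[OF lim]]) simp
    then show ?thesis ..
  qed
  then obtain c :: real and N where N: "\<And>t. N \<le> t \<Longrightarrow> indicator {0..p} (h t) = c"
    by (auto simp: eventually_at_top_linorder)
  show ?thesis by (rule exI[of _ "max 0 N"]) (simp add: N)
qed

text \<open>A level that is eventually not crossed bounds the trajectory from above or strictly from below.
  Above the lower limit only the first is possible, and such levels come arbitrarily close to it.\<close>

lemma converges_if_threshold_constant_on_dense:
  fixes h :: "real \<Rightarrow> real"
  assumes range: "\<And>t. 0 \<le> t \<Longrightarrow> h t \<in> {0..1}"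
    and dense: "\<And>a b. 0 \<le> a \<Longrightarrow> a < b \<Longrightarrow> b \<le> 1 \<Longrightarrow>
      \<exists>p\<in>{a<..<b}. \<exists>T\<ge>0. \<forall>t\<ge>T. (indicator {0..p} (h t) :: real) = indicator {0..p} (h T)"
  shows "\<exists>L. (h \<longlongrightarrow> L) at_top"
proof
  \<comment> \<open>The supremum below is the lower limit of the trajectory; the levels in \<open>dense\<close> force the upper
    limit down to it.\<close>
  define A where "A = {a. eventually (\<lambda>t. a \<le> h t) at_top}"
  have ev_range: "eventually (\<lambda>t. 0 \<le> h t \<and> h t \<le> 1) at_top"
    using eventually_ge_at_top[of 0] by eventually_elim (use range in auto)
  then have zero: "0 \<in> A" unfolding A_def mem_Collect_eq by eventually_elim simp
  have le1: "a \<le> 1" if "a \<in> A" for a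
  proof -
    from that have "eventually (\<lambda>t. a \<le> h t) at_top" by (simp add: A_def)
    with ev_range have "eventually (\<lambda>t::real. a \<le> 1) at_top" by eventually_elim simp
    then show ?thesis by simp
  qed
  then have bdd: "bdd_above A" by (rule bdd_aboveI)
  have Sup_nonneg: "0 \<le> Sup A" by (rule cSup_upper[OF zero bdd])
  show "(h \<longlongrightarrow> Sup A) at_top"
  proof (rule order_tendstoI)
    fix c assume "c < Sup A"
    then obtain a where a: "a \<in> A" "c < a"
      using less_cSup_iff[of A c] zero bdd by auto
    then have "eventually (\<lambda>t. a \<le> h t) at_top" by (simp add: A_def)
    then show "eventually (\<lambda>t. c < h t) at_top"
      by eventually_elim (use a(2) in simp)
  next
    fix c assume c: "Sup A < c"
    show "eventually (\<lambda>t. h t < c) at_top"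
    proof (cases "c \<le> 1")
      case False
      show ?thesis using ev_range by eventually_elim (use False in simp)
    next
      case True
      obtain p where "p \<in> {Sup A<..<c}"
        and "\<exists>T\<ge>0. \<forall>t\<ge>T. (indicator {0..p} (h t) :: real) = indicator {0..p} (h T)"
        using dense[OF Sup_nonneg c True] by (rule bexE)
      then obtain T where p: "Sup A < p" "p < c" and T: "0 \<le> T"
        and "\<forall>t\<ge>T. (indicator {0..p} (h t) :: real) = indicator {0..p} (h T)"
        unfolding greaterThanLessThan_iff by (elim exE conjE)
      note const = this(4)[rule_format]
      have ind: "(indicator {0..p} (h t) :: real) = (if h t \<le> p then 1 else 0)" if "T \<le> t" for t
        using range[of t] T that by simp
      have iff: "h t \<le> p \<longleftrightarrow> h T \<le> p" if "T \<le> t" for t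
        using const[OF that] ind[OF that] ind[of T] by (simp split: if_splits)
      have "h T \<le> p"
      proof (rule ccontr)
        assume "\<not> h T \<le> p"
        then have "p \<le> h t" if "T \<le> t" for t using iff[OF that] by linarith
        then have "p \<in> A" unfolding A_def mem_Collect_eq
          by (rule eventually_mono[OF eventually_ge_at_top])
        then have "p \<le> Sup A" using bdd by (rule cSup_upper)
        with p show False by simp
      qed
      then have "h t < c" if "T \<le> t" for t using iff[OF that] p by linarith
      then show ?thesis by (rule eventually_mono[OF eventually_ge_at_top])
    qed
  qed
qed

section \<open>Exceptional levels\<close>

text \<open>The law of the limit is a finite measure, hence has countably many atoms. The limit is taken
  along the integers, which makes it a random variable on the nose instead of almost surely.\<close>

lemma (in prob_space) countable_nonfixating_levels:
  fixes \<eta> :: "real \<Rightarrow> 'v \<Rightarrow> 'a \<Rightarrow> real"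
  assumes V: "countable V"
    and rv: "\<And>x t. x \<in> V \<Longrightarrow> 0 \<le> t \<Longrightarrow> random_variable borel (\<eta> t x)"
    and nonneg: "AE \<omega> in M. \<forall>x\<in>V. \<forall>t\<ge>0. 0 \<le> \<eta> t x \<omega>"
    and conv: "converges_almost_surely M V \<eta>"
  shows "countable {p. \<not> fixates M V (threshold \<eta> p)}"
proof -
  define L where "L x \<omega> = lim (\<lambda>n. \<eta> (real n) x \<omega>)" for x \<omega>
  have L_rv: "random_variable borel (L x)" if "x \<in> V" for x
    unfolding L_def by (rule borel_measurable_lim_metric) (use rv that in auto)
  define C where "C x = {p. measure (distr M borel (L x)) {p} \<noteq> 0}" for x
  have C: "countable (C x)" if "x \<in> V" for x
  proof -
    interpret D: prob_space "distr M borel (L x)" by (rule prob_space_distr) (rule L_rv[OF that])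
    show ?thesis unfolding C_def by (rule D.countable_support)
  qed
  have "fixates M V (threshold \<eta> p)" if p: "p \<notin> (\<Union>x\<in>V. C x)" for p
    unfolding fixates_def
  proof
    fix x assume x: "x \<in> V"
    note L_rv[OF x, measurable]
    have "prob {\<omega> \<in> space M. L x \<omega> = p} = measure (distr M borel (L x)) {p}"
      by (subst measure_distr) (auto intro!: arg_cong[where f = prob])
    also have "\<dots> = 0" using p x by (auto simp: C_def)
    finally have "AE \<omega> in M. L x \<omega> \<noteq> p"
      by (subst (asm) prob_Collect_eq_0) auto
    moreover have "AE \<omega> in M. \<exists>l. ((\<lambda>t. \<eta> t x \<omega>) \<longlongrightarrow> l) at_top"
      using conv x by (auto simp: converges_almost_surely_def)
    ultimately show "AE \<omega> in M. \<exists>T\<ge>0. \<forall>t\<ge>T. threshold \<eta> p t x \<omega> = threshold \<eta> p T x \<omega>"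
      using nonneg
    proof eventually_elim
      case (elim \<omega>)
      then obtain l where l: "((\<lambda>t. \<eta> t x \<omega>) \<longlongrightarrow> l) at_top" by blast
      then have "(\<lambda>n. \<eta> (real n) x \<omega>) \<longlonglongrightarrow> l"
        by (rule filterlim_compose[OF _ filterlim_real_sequentially])
      then have "L x \<omega> = l" unfolding L_def by (rule limI)
      with elim have "l \<noteq> p" by simp
      then show ?case unfolding threshold_def
        by (intro threshold_eventually_constant[OF _ l]) (use elim x in auto)
    qed
  qed
  then have "{p. \<not> fixates M V (threshold \<eta> p)} \<subseteq> (\<Union>x\<in>V. C x)" by blast
  then show ?thesis by (rule countable_subset) (use V C in auto)
qed

text \<open>Almost sure fixation is known for each single level, with a null set depending on the level.
  Intervals with rational endpoints reduce the density of the fixating levels to countably many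
  almost sure statements.\<close>

lemma (in prob_space) converges_if_fixates_on_dense_levels:
  fixes \<eta> :: "real \<Rightarrow> 'v \<Rightarrow> 'a \<Rightarrow> real"
  assumes range: "AE \<omega> in M. \<forall>x\<in>V. \<forall>t\<ge>0. \<eta> t x \<omega> \<in> {0..1}"
    and dense: "\<And>a b. 0 \<le> a \<Longrightarrow> a < b \<Longrightarrow> b \<le> 1 \<Longrightarrow>
      \<exists>p\<in>{a<..<b}. fixates M V (threshold \<eta> p)"
  shows "converges_almost_surely M V \<eta>"
  unfolding converges_almost_surely_def
proof
  fix x assume x: "x \<in> V"
  let ?const = "\<lambda>p \<omega>. \<exists>T\<ge>0. \<forall>t\<ge>T. threshold \<eta> p t x \<omega> = threshold \<eta> p T x \<omega>"
  have "AE \<omega> in M. 0 \<le> real_of_rat a \<longrightarrow> real_of_rat a < real_of_rat b \<longrightarrow> real_of_rat b \<le> 1 \<longrightarrow>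
      (\<exists>p\<in>{real_of_rat a<..<real_of_rat b}. ?const p \<omega>)" for a b
  proof (cases "0 \<le> real_of_rat a \<and> real_of_rat a < real_of_rat b \<and> real_of_rat b \<le> 1")
    case True
    then obtain p where p: "p \<in> {real_of_rat a<..<real_of_rat b}"
      and "fixates M V (threshold \<eta> p)"
      using dense by blast
    then have "AE \<omega> in M. ?const p \<omega>" using x by (simp add: fixates_def)
    then show ?thesis by eventually_elim (use p in blast)
  qed auto
  then have "AE \<omega> in M. \<forall>a b. 0 \<le> real_of_rat a \<longrightarrow> real_of_rat a < real_of_rat b \<longrightarrow>
      real_of_rat b \<le> 1 \<longrightarrow> (\<exists>p\<in>{real_of_rat a<..<real_of_rat b}. ?const p \<omega>)"
    unfolding AE_all_countable by (intro allI)
  then show "AE \<omega> in M. \<exists>L. ((\<lambda>t. \<eta> t x \<omega>) \<longlongrightarrow> L) at_top"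
    using range
  proof eventually_elim
    case (elim \<omega>)
    show ?case
    proof (rule converges_if_threshold_constant_on_dense)
      show "\<eta> t x \<omega> \<in> {0..1}" if "0 \<le> t" for t using elim(2) x that by blast
      fix a b :: real assume ab: "0 \<le> a" "a < b" "b \<le> 1"
      obtain r where r: "a < real_of_rat r" "real_of_rat r < b" using of_rat_dense[OF ab(2)] by blast
      obtain s where s: "real_of_rat r < real_of_rat s" "real_of_rat s < b"
        using of_rat_dense[OF r(2)] by blast
      have "\<exists>p\<in>{real_of_rat r<..<real_of_rat s}. ?const p \<omega>"
        by (rule elim(1)[rule_format, of r s]) (use ab r s in linarith)+
      moreover have "{real_of_rat r<..<real_of_rat s} \<subseteq> {a<..<b}" using r s by auto
      ultimately show "\<exists>p\<in>{a<..<b}. \<exists>T\<ge>0. \<forall>t\<ge>T.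
          (indicator {0..p} (\<eta> t x \<omega>) :: real) = indicator {0..p} (\<eta> T x \<omega>)"
        unfolding threshold_def by blast
    qed
  qed
qed

lemma full_measure_imp_dense:
  fixes A :: "real set"
  assumes A: "A \<subseteq> {0..1}" "A \<in> sets lebesgue" "emeasure lebesgue A = emeasure lebesgue {0..1::real}"
    and ab: "0 \<le> a" "a < b" "b \<le> 1"
  shows "\<exists>p\<in>{a<..<b}. p \<in> A"
proof (rule ccontr)
  assume "\<not> ?thesis"
  then have disj: "{a<..<b} \<inter> A = {}" by auto
  have "ennreal (b - a) + 1 = emeasure lebesgue {a<..<b} + emeasure lebesgue A"
    using ab A(3) by simp
  also have "\<dots> = emeasure lebesgue ({a<..<b} \<union> A)"
    by (rule plus_emeasure[OF _ A(2) disj]) simp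
  also have "\<dots> \<le> emeasure lebesgue {0..1::real}"
    by (rule emeasure_mono) (use A(1) ab in auto)
  finally have "ennreal (b - a) + ennreal 1 \<le> ennreal 1" by simp
  then show False using ab by (simp add: ennreal_plus[symmetric] del: ennreal_plus ennreal_1)
qed

section \<open>Convergence and fixation\<close>

theorem proposition4p1:
  fixes M :: "'w measure" and V :: "'v set" and E :: "'v rel"
    and W :: "'v \<Rightarrow> nat \<Rightarrow> 'w \<Rightarrow> real"
    and \<eta> :: "real \<Rightarrow> 'v \<Rightarrow> 'w \<Rightarrow> real"
  assumes "locally_finite_graph V E"
    and "median_well_defined V E"
    and "median_dynamics M V E W \<eta>"
  shows "converges_almost_surely M V \<eta> \<longleftrightarrow>
    {p \<in> {0..1}. fixates M V (threshold \<eta> p)} \<in> sets lebesgue \<and>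
    emeasure lebesgue {p \<in> {0..1}. fixates M V (threshold \<eta> p)} = emeasure lebesgue {0..1::real}"
    (is "?conv \<longleftrightarrow> ?F \<in> sets lebesgue \<and> _")
proof -
  interpret clock_dynamics M V E "{0..1}" median_on "uniform_measure lborel {0..1}" W \<eta>
    using assms(3) unfolding median_dynamics_def .
  have range: "AE \<omega> in M. \<forall>x\<in>V. \<forall>t\<ge>0. \<eta> t x \<omega> \<in> {0..1}"
    using evolution unfolding trajectory_def by (rule eventually_mono) (erule conjunct1)
  show ?thesis
  proof
    assume conv: ?conv
    define B where "B = {p. \<not> fixates M V (threshold \<eta> p)}"
    have "countable B"
      unfolding B_def
    proof (rule countable_nonfixating_levels[OF countable_vertices _ _ conv])
      show "random_variable borel (\<eta> t x)" if "x \<in> V" "0 \<le> t" for x t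
        using that by (rule random_variable)
      show "AE \<omega> in M. \<forall>x\<in>V. \<forall>t\<ge>0. 0 \<le> \<eta> t x \<omega>"
        using range by eventually_elim simp
    qed
    then have null: "B \<in> null_sets lebesgue"
      by (simp add: countable_imp_null_set_lborel null_sets_completionI)
    have F: "?F = {0..1} - B" by (auto simp: B_def)
    have "{0..1} - B \<in> sets lebesgue" by (intro sets.Diff null_setsD2[OF null]) simp
    moreover have "emeasure lebesgue ({0..1} - B) = emeasure lebesgue {0..1::real}"
      by (rule emeasure_Diff_null_set[OF null]) simp
    ultimately show "?F \<in> sets lebesgue \<and> emeasure lebesgue ?F = emeasure lebesgue {0..1::real}"
      unfolding F ..
  next
    assume F: "?F \<in> sets lebesgue \<and> emeasure lebesgue ?F = emeasure lebesgue {0..1::real}"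
    show ?conv
    proof (rule converges_if_fixates_on_dense_levels[OF range])
      fix a b :: real assume ab: "0 \<le> a" "a < b" "b \<le> 1"
      have "\<exists>p\<in>{a<..<b}. p \<in> ?F" by (rule full_measure_imp_dense) (use F ab in auto)
      then show "\<exists>p\<in>{a<..<b}. fixates M V (threshold \<eta> p)" by blast
    qed
  qed
qed

end
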